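(* Let $a,b>0$ and $\theta\ge 0$, and define $$p_{a,b,\theta}(x)=\frac{b^a e^{-\theta}}{\Gamma(a)}\,x^{a-1}e^{-bx}\,{}_0F_1(;a;b\theta x),\qquad x>0.$$ Then $p_{a,b,\theta}$ is hyperbolically completely monotone if and only if $\theta=0$. Equivalently, $p_{a,b,0}$ (the gamma density with shape $a$ and rate $b$) is hyperbolically completely monotone, and $p_{a,b,\theta}$ is not hyperbolically completely monotone for any $\theta>0$.
   Context: Here ${}_0F_1(;a;z)=\sum_{m=0}^{\infty}\frac{z^m}{m!\,(a)_m}$ with $(a)_m=\Gamma(a+m)/\Gamma(a)$. A positive function $f$ on $(0,\infty)$ is hyperbolically completely monotone (HCM) if for every $u>0$ the function $v\mapsto f(uv)f(u/v)$ is completely monotone as a function of $w=v+v^{-1}$ on $(2,\infty)$; that is, for every $u>0$ the function $$H_u(w)=f(u\,v(w))\,f(u/v(w)),\qquad v(w)=\frac{w+\sqrt{w^2-4}}{2},\qquad w>2,$$ has derivatives of all orders on $(2,\infty)$ and satisfies $(-1)^n H_u^{(n)}(w)\ge 0$ for all integers $n\ge 0$ and all $w>2$. *)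

theory Defs
  imports "HOL-Analysis.Analysis"
begin

text \<open>
  Meant for open sets \<open>A\<close>: there the iterates of \<^const>\<open>deriv\<close> are the usual
  higher derivatives and depend only on the values of \<open>f\<close> on \<open>A\<close>.
\<close>

definition completely_monotone_on :: "real set \<Rightarrow> (real \<Rightarrow> real) \<Rightarrow> bool" where
  "completely_monotone_on A f \<longleftrightarrow>
     (\<forall>n. \<forall>x\<in>A. (deriv ^^ n) f field_differentiable (at x) \<and> (-1) ^ n * (deriv ^^ n) f x \<ge> 0)"

text \<open>The solution \<open>v > 1\<close> of \<open>v + 1 / v = w\<close>, for \<open>w > 2\<close>.\<close>

definition hcm_v :: "real \<Rightarrow> real" where
  "hcm_v w = (w + sqrt (w\<^sup>2 - 4)) / 2"

lemma hcm_v_plus_inverse: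
  fixes w :: real
  assumes "w > 2"
  shows "hcm_v w > 1" and "hcm_v w + 1 / hcm_v w = w"
proof -
  have "2\<^sup>2 < w\<^sup>2"
    using assms by (intro power_strict_mono) auto
  then have s: "sqrt (w\<^sup>2 - 4) * sqrt (w\<^sup>2 - 4) = w\<^sup>2 - 4" and s0: "sqrt (w\<^sup>2 - 4) \<ge> 0"
    by auto
  show *: "hcm_v w > 1"
    using add_less_le_mono[OF assms s0] by (simp add: hcm_v_def)
  have "hcm_v w * hcm_v w + 1 = w * hcm_v w"
    using s by (simp add: hcm_v_def field_simps power2_eq_square)
  with * show "hcm_v w + 1 / hcm_v w = w"
    by (simp add: field_simps)
qed

text \<open>Only the values of \<open>f\<close> on the open half-line \<open>(0, \<infinity>)\<close> matter.\<close>

definition hyperbolically_completely_monotone :: "(real \<Rightarrow> real) \<Rightarrow> bool" where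
  "hyperbolically_completely_monotone f \<longleftrightarrow>
     (\<forall>x>0. f x > 0) \<and>
     (\<forall>u>0. completely_monotone_on {2<..} (\<lambda>w. f (u * hcm_v w) * f (u / hcm_v w)))"

definition hypergeom_0F1 :: "real \<Rightarrow> real \<Rightarrow> real" where
  "hypergeom_0F1 a z = (\<Sum>m. z ^ m / (fact m * pochhammer a m))"

lemma hypergeom_0F1_Gamma:
  assumes "a > 0"
  shows "hypergeom_0F1 a z = (\<Sum>m. z ^ m / (fact m * (Gamma (a + real m) / Gamma a)))"
proof -
  have "a \<notin> \<int>\<^sub>\<le>\<^sub>0"
    using assms by (auto elim!: nonpos_Ints_cases)
  then show ?thesis
    by (simp add: hypergeom_0F1_def pochhammer_Gamma)
qed

definition noncentral_gamma_density :: "real \<Rightarrow> real \<Rightarrow> real \<Rightarrow> real \<Rightarrow> real" where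
  "noncentral_gamma_density a b \<theta> x =
     b powr a * exp (- \<theta>) / Gamma a * x powr (a - 1) * exp (- b * x) *
     hypergeom_0F1 a (b * \<theta> * x)"

end

theory Submission
  imports Defs
begin

text \<open>
  For \<open>\<theta> = 0\<close> the function of \<open>w\<close> is a constant times \<open>exp (- b u w)\<close>.  For \<open>\<theta> > 0\<close> it is
  \<open>exp (- b u w) G(w)\<close> up to a constant, with \<open>G(w) = F(s v) F(s / v)\<close>, \<open>s = b \<theta> u\<close>,
  \<open>F = \<^sub>0F\<^sub>1(;a;\<cdot>)\<close>.  Completely monotone functions are log-convex, and log-convexity
  does not see the exponential factor, so it would give \<open>G(3) G(5) \<ge> G(4)\<^sup>2\<close> for every \<open>s > 0\<close>.
  But \<open>G(w) = 1 + s w / a + s\<^sup>2 ((w\<^sup>2 - 2) / (2 a (a + 1)) + 1 / a\<^sup>2) + o(s\<^sup>2)\<close>, whence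
  \<open>G(3) G(5) - G(4)\<^sup>2 = s\<^sup>2 (1 / (a (a + 1)) - 1 / a\<^sup>2) + o(s\<^sup>2)\<close>, which is negative for small \<open>s\<close>.

  Log-convexity follows from Hausdorff's moment argument: the iterated differences of a completely
  monotone function with step \<open>h\<close> provide nonnegative weights on \<open>{0..n}\<close> whose moments of order
  \<open>0, 1, 2\<close>, suitably normalised, tend to \<open>f x\<close>, \<open>f (x + h)\<close>, \<open>f (x + 2 h)\<close> as \<open>n \<rightarrow> \<infinity>\<close>.
\<close>

section \<open>Hausdorff's moment argument for sequences\<close>

text \<open>Here \<open>d m\<close> is the \<open>m\<close>-th iterated difference of the sequence
  \<open>d 0\<close>. Pascal's rule splits the sum in two, and the recurrence for \<open>d\<close>
  cancels the unwanted half. The case \<open>i = 0\<close> gives the total mass of the weights; the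
  shifts \<open>i = 1, 2\<close> serve the higher moments.\<close>

lemma sum_binomial_differences:
  fixes d :: "nat \<Rightarrow> nat \<Rightarrow> real"
  assumes d: "\<And>m k. d (Suc m) k = d m k - d m (Suc k)"
  shows "(\<Sum>j\<le>n. real (n choose j) * d (n - j) (j + i)) = d 0 i"
proof (induction n arbitrary: i)
  case 0
  show ?case by simp
next
  case (Suc n)
  have "(\<Sum>j\<le>Suc n. real (Suc n choose j) * d (Suc n - j) (j + i))
      = d (Suc n) i + (\<Sum>j\<le>n. real (Suc n choose Suc j) * d (n - j) (Suc j + i))"
    by (subst sum.atMost_Suc_shift) simp
  also have "\<dots> = (d (Suc n) i + (\<Sum>j\<le>n. real (n choose Suc j) * d (n - j) (Suc j + i)))
      + (\<Sum>j\<le>n. real (n choose j) * d (n - j) (j + Suc i))"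
    by (simp add: sum.distrib algebra_simps)
  also have "d (Suc n) i + (\<Sum>j\<le>n. real (n choose Suc j) * d (n - j) (Suc j + i))
      = (\<Sum>j\<le>Suc n. real (n choose j) * d (Suc n - j) (j + i))"
    by (subst sum.atMost_Suc_shift) simp
  also have "\<dots> = (\<Sum>j\<le>n. real (n choose j) * d (Suc (n - j)) (j + i))"
    by (simp add: Suc_diff_le)
  also have "\<dots> = (\<Sum>j\<le>n. real (n choose j) * d (n - j) (j + i))
      - (\<Sum>j\<le>n. real (n choose j) * d (n - j) (j + Suc i))"
    by (simp add: d sum_subtractf algebra_simps)
  finally show ?case
    by (simp add: Suc.IH)
qed

text \<open>The absorption identity for binomial coefficients trades a factor \<open>j\<close> of a
  moment for a shift of the sequence by one. The factor \<open>g\<close> carries what is left, so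
  that a second application reaches second moments.\<close>

lemma sum_binomial_absorb:
  fixes d :: "nat \<Rightarrow> nat \<Rightarrow> real"
  shows "(\<Sum>j\<le>Suc n. real j * g j * (real (Suc n choose j) * d (Suc n - j) (j + i)))
    = real (Suc n) * (\<Sum>j\<le>n. g (Suc j) * (real (n choose j) * d (n - j) (j + Suc i)))"
proof -
  have *: "real (Suc j) * real (Suc n choose Suc j) = real (Suc n) * real (n choose j)" for j
    using Suc_times_binomial[of j n] by (metis of_nat_mult)
  have "(\<Sum>j\<le>Suc n. real j * g j * (real (Suc n choose j) * d (Suc n - j) (j + i)))
    = (\<Sum>j\<le>n. (real (Suc j) * real (Suc n choose Suc j)) * g (Suc j) * d (n - j) (j + Suc i))"
    by (subst sum.atMost_Suc_shift) (simp add: mult_ac del: binomial_Suc_Suc of_nat_Suc)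
  also have "\<dots> = (\<Sum>j\<le>n. (real (Suc n) * real (n choose j)) * g (Suc j) * d (n - j) (j + Suc i))"
    by (simp only: *)
  finally show ?thesis
    by (simp add: sum_distrib_left mult_ac)
qed

text \<open>The weighted sum of \<open>(j - t * N)\<^sup>2\<close> is nonnegative for every real
  \<open>t\<close>. Divided by \<open>N\<^sup>2\<close>, it tends to a quadratic polynomial in
  \<open>t\<close>, whose nonnegativity is the claim.\<close>

lemma completely_monotone_sequence_log_convex:
  fixes d :: "nat \<Rightarrow> nat \<Rightarrow> real"
  assumes d: "\<And>m k. d (Suc m) k = d m k - d m (Suc k)"
    and nonneg: "\<And>m k. d m k \<ge> 0" and pos: "d 0 0 > 0"
  shows "(d 0 1)\<^sup>2 \<le> d 0 0 * d 0 2"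
proof -
  have quadratic: "0 \<le> d 0 2 - 2 * t * d 0 1 + t\<^sup>2 * d 0 0" for t
  proof (rule tendsto_lowerbound[OF _ always_eventually[OF allI]])
    fix n :: nat
    define N where "N = real (Suc (Suc n))"
    have N: "N > 0" by (simp add: N_def)
    define L where "L j = real (Suc (Suc n) choose j) * d (Suc (Suc n) - j) (j + 0)" for j
    note S = sum_binomial_differences[of d, OF d]
    have m0: "(\<Sum>j\<le>Suc (Suc n). L j) = d 0 0"
      unfolding L_def by (rule S)
    have m1: "(\<Sum>j\<le>Suc (Suc n). real j * L j) = N * d 0 1"
      using sum_binomial_absorb[of "\<lambda>_. 1" "Suc n" d 0] S[of "Suc n" "Suc 0"]
      by (simp only: L_def N_def mult_1_right mult_1 One_nat_def)
    \<comment> \<open>The factorial moment absorbs twice: first with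
      \<open>g j = real j - 1\<close>, which becomes \<open>real j\<close> after the shift, then
      with \<open>g = 1\<close>.\<close>
    have m2: "(\<Sum>j\<le>Suc (Suc n). real j * (real j - 1) * L j) = N * (N - 1) * d 0 2"
      using sum_binomial_absorb[of "\<lambda>j. real j - 1" "Suc n" d 0]
        sum_binomial_absorb[of "\<lambda>_. 1" n d "Suc 0"] S[of n 2]
      by (simp add: L_def N_def numeral_2_eq_2 del: sum.atMost_Suc binomial_Suc_Suc)
    have "0 \<le> (\<Sum>j\<le>Suc (Suc n). (real j - t * N)\<^sup>2 * L j)"
      by (intro sum_nonneg mult_nonneg_nonneg) (auto simp: L_def nonneg)
    also have "\<dots> = (\<Sum>j\<le>Suc (Suc n). real j * (real j - 1) * L j + (1 - 2 * t * N) * (real j * L j)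
        + (t * N)\<^sup>2 * L j)"
      by (intro sum.cong refl) (simp add: algebra_simps power2_eq_square)
    also have "\<dots> = N * (N - 1) * d 0 2 + (1 - 2 * t * N) * (N * d 0 1) + (t * N)\<^sup>2 * d 0 0"
      by (simp only: sum.distrib sum_distrib_left[symmetric] m0 m1 m2)
    also have "\<dots> = N\<^sup>2 * ((1 - 1 / N) * d 0 2 + (1 / N) * d 0 1 - 2 * t * d 0 1 + t\<^sup>2 * d 0 0)"
      using N by (simp add: field_simps power2_eq_square)
    finally show "0 \<le> (1 - 1 / real (Suc (Suc n))) * d 0 2 + (1 / real (Suc (Suc n))) * d 0 1
        - 2 * t * d 0 1 + t\<^sup>2 * d 0 0"
      by (simp add: N_def zero_le_mult_iff)
  next
    have lim: "(\<lambda>n. 1 / real (Suc (Suc n))) \<longlonglongrightarrow> 0"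
      using LIMSEQ_Suc[OF lim_1_over_n[where ?'a = real]] LIMSEQ_Suc by blast
    have "(\<lambda>n. (1 - 1 / real (Suc (Suc n))) * d 0 2 + (1 / real (Suc (Suc n))) * d 0 1
        - 2 * t * d 0 1 + t\<^sup>2 * d 0 0)
      \<longlonglongrightarrow> (1 - 0) * d 0 2 + 0 * d 0 1 - 2 * t * d 0 1 + t\<^sup>2 * d 0 0"
      by (intro tendsto_intros lim)
    then show "(\<lambda>n. (1 - 1 / real (Suc (Suc n))) * d 0 2 + (1 / real (Suc (Suc n))) * d 0 1
        - 2 * t * d 0 1 + t\<^sup>2 * d 0 0)
      \<longlonglongrightarrow> d 0 2 - 2 * t * d 0 1 + t\<^sup>2 * d 0 0"
      by simp
  qed auto
  \<comment> \<open>This \<open>t\<close> is the minimiser of the quadratic.\<close>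
  have "0 \<le> d 0 0 * (d 0 2 - 2 * (d 0 1 / d 0 0) * d 0 1 + (d 0 1 / d 0 0)\<^sup>2 * d 0 0)"
    by (intro mult_nonneg_nonneg quadratic less_imp_le[OF pos])
  also have "\<dots> = d 0 0 * d 0 2 - (d 0 1)\<^sup>2"
    using pos by (simp add: field_simps power2_eq_square)
  finally show ?thesis by simp
qed

section \<open>Completely monotone functions\<close>

lemma completely_monotone_on_DERIV:
  assumes "completely_monotone_on A f" "x \<in> A"
  shows "((deriv ^^ n) f has_real_derivative (deriv ^^ Suc n) f x) (at x)"
  using assms by (simp add: completely_monotone_on_def DERIV_deriv_iff_field_differentiable)

lemma completely_monotone_on_nonneg:
  assumes "completely_monotone_on A f" "x \<in> A"
  shows "f x \<ge> 0"
  using assms unfolding completely_monotone_on_def by (metis funpow_0 mult_1 power_0)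

text \<open>Each \<open>(-1) ^ n * (deriv ^^ n) f\<close> has a nonpositive derivative, hence is
  nonincreasing on the half-line.\<close>

lemma completely_monotone_on_difference:
  assumes f: "completely_monotone_on {c<..} f" and h: "h \<ge> 0"
  shows "completely_monotone_on {c<..} (\<lambda>x. f x - f (x + h))"
proof -
  let ?D = "\<lambda>n. (deriv ^^ n) f"
  have D: "((\<lambda>x. ?D n x - ?D n (x + h)) has_real_derivative ?D (Suc n) x - ?D (Suc n) (x + h)) (at x)"
    if "x > c" for n x
  proof (intro DERIV_diff)
    show "(?D n has_real_derivative ?D (Suc n) x) (at x)"
      using that by (intro completely_monotone_on_DERIV[OF f]) auto
    show "((\<lambda>x. ?D n (x + h)) has_real_derivative ?D (Suc n) (x + h)) (at x)"
      using that h by (subst DERIV_shift[symmetric]) (intro completely_monotone_on_DERIV[OF f], auto)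
  qed
  \<comment> \<open>The derivatives are known only for \<open>x > c\<close>, so the induction passes
    through the open half-line at each step.\<close>
  have higher: "(deriv ^^ n) (\<lambda>x. f x - f (x + h)) x = ?D n x - ?D n (x + h)" if "x > c" for n x
    using that
  proof (induction n arbitrary: x)
    case (Suc n)
    have "((deriv ^^ n) (\<lambda>x. f x - f (x + h)) has_real_derivative ?D (Suc n) x - ?D (Suc n) (x + h)) (at x)"
      by (rule has_field_derivative_transform_within_open[OF D[OF Suc.prems], of "{c<..}"])
         (use Suc in auto)
    then show ?case by (simp add: DERIV_imp_deriv)
  qed simp
  show ?thesis
    unfolding completely_monotone_on_def
  proof (intro allI ballI conjI)
    fix n x assume "x \<in> {c<..}"
    then have x: "x > c" by simp
    have "((deriv ^^ n) (\<lambda>x. f x - f (x + h)) has_real_derivative ?D (Suc n) x - ?D (Suc n) (x + h)) (at x)"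
      by (rule has_field_derivative_transform_within_open[OF D[OF x], of "{c<..}"])
         (use higher x in auto)
    then show "(deriv ^^ n) (\<lambda>x. f x - f (x + h)) field_differentiable at x"
      using field_differentiable_def by blast
    have "(-1) ^ n * ?D n (x + h) \<le> (-1) ^ n * ?D n x"
    proof (rule DERIV_nonpos_imp_nonincreasing[where f = "\<lambda>y. (-1) ^ n * ?D n y"])
      fix y assume "x \<le> y" "y \<le> x + h"
      with x have y: "y \<in> {c<..}" by simp
      have "(-1) ^ Suc n * ?D (Suc n) y \<ge> 0"
        using f y unfolding completely_monotone_on_def by blast
      then show "\<exists>z. ((\<lambda>y. (-1) ^ n * ?D n y) has_real_derivative z) (at y) \<and> z \<le> 0"
        by (intro exI[of _ "(-1) ^ n * ?D (Suc n) y"] conjI DERIV_cmult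
              completely_monotone_on_DERIV[OF f y]) simp
    qed (use h in simp)
    then show "0 \<le> (-1) ^ n * (deriv ^^ n) (\<lambda>x. f x - f (x + h)) x"
      by (simp add: higher x right_diff_distrib)
  qed
qed

text \<open>Sampling at \<open>x + real k * h\<close> reduces this to sequences: all iterated
  differences of \<open>f\<close> with step \<open>h\<close> are again completely monotone, hence
  nonnegative.\<close>

lemma completely_monotone_on_log_convex:
  assumes f: "completely_monotone_on {c<..} f" and x: "x > c" and h: "h \<ge> 0" and pos: "f x > 0"
  shows "(f (x + h))\<^sup>2 \<le> f x * f (x + 2 * h)"
proof -
  define \<Delta> where "\<Delta> m = ((\<lambda>g x. g x - g (x + h)) ^^ m) f" for m :: nat
  define d where "d m k = \<Delta> m (x + real k * h)" for m k
  have "completely_monotone_on {c<..} (\<Delta> m)" for m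
    by (induction m) (simp_all add: \<Delta>_def f h completely_monotone_on_difference)
  then have "d m k \<ge> 0" for m k
    unfolding d_def using x h
    by (intro completely_monotone_on_nonneg[where A = "{c<..}" and f = "\<Delta> m"])
       (auto intro: less_le_trans[of c x])
  moreover have "d (Suc m) k = d m k - d m (Suc k)" for m k
    by (simp add: d_def \<Delta>_def algebra_simps)
  moreover have "d 0 0 > 0"
    using pos by (simp add: d_def \<Delta>_def)
  ultimately have "(d 0 1)\<^sup>2 \<le> d 0 0 * d 0 2"
    by (intro completely_monotone_sequence_log_convex)
  then show ?thesis
    by (simp add: d_def \<Delta>_def)
qed

lemma completely_monotone_on_exp:
  fixes f :: "real \<Rightarrow> real"
  assumes A: "open A" and K: "K \<ge> 0" and c: "c \<ge> 0"
    and f: "\<And>x. x \<in> A \<Longrightarrow> f x = K * exp (- c * x)"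
  shows "completely_monotone_on A f"
proof -
  have D: "((\<lambda>x. (- c) ^ n * K * exp (- c * x)) has_real_derivative (- c) ^ Suc n * K * exp (- c * x)) (at x)"
    for n x
    by (auto intro!: derivative_eq_intros)
  have higher: "(deriv ^^ n) f x = (- c) ^ n * K * exp (- c * x)" if "x \<in> A" for n x
    using that
  proof (induction n arbitrary: x)
    case (Suc n)
    have "((deriv ^^ n) f has_real_derivative (- c) ^ Suc n * K * exp (- c * x)) (at x)"
      by (rule has_field_derivative_transform_within_open[OF D A Suc.prems]) (use Suc.IH in auto)
    then show ?case by (simp add: DERIV_imp_deriv)
  qed (simp add: f)
  show ?thesis
    unfolding completely_monotone_on_def
  proof (intro allI ballI conjI)
    fix n x assume x: "x \<in> A"
    have "((deriv ^^ n) f has_real_derivative (- c) ^ Suc n * K * exp (- c * x)) (at x)"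
      by (rule has_field_derivative_transform_within_open[OF D A x]) (use higher in auto)
    then show "(deriv ^^ n) f field_differentiable at x"
      using field_differentiable_def by blast
    have "(-1) ^ n * (deriv ^^ n) f x = c ^ n * K * exp (- c * x)"
      using power_mult_distrib[of "-1" "- c" n] by (simp add: higher x)
    then show "0 \<le> (-1) ^ n * (deriv ^^ n) f x"
      using K c by simp
  qed
qed

section \<open>The hypergeometric series near zero\<close>

lemma summable_hypergeom_0F1:
  fixes a z :: real
  assumes a: "a > 0"
  shows "summable (\<lambda>m. (1 / (fact m * pochhammer a m)) * z ^ m)"
proof (rule summable_ratio_test)
  \<comment> \<open>The threshold ensures both \<open>2 * \<bar>z\<bar> \<le> n + 1\<close> and
    \<open>1 \<le> a + n\<close>, which bounds the ratio of consecutive terms by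
    \<open>1 / 2\<close>.\<close>
  fix n assume n: "nat \<lceil>2 * \<bar>z\<bar>\<rceil> + 1 \<le> n"
  define c where "c = 1 / (fact n * pochhammer a n)"
  have c: "c > 0"
    using a by (simp add: c_def pochhammer_pos)
  have "2 * \<bar>z\<bar> \<le> real n" "1 \<le> real n"
    using n by linarith+
  then have "2 * \<bar>z\<bar> * 1 \<le> (real n + 1) * (a + real n)"
    using a by (intro mult_mono) auto
  then have ratio: "\<bar>z\<bar> / ((real n + 1) * (a + real n)) \<le> 1 / 2"
    using a by (simp add: divide_simps add_pos_nonneg)
  have "norm (1 / (fact (Suc n) * pochhammer a (Suc n)) * z ^ Suc n)
      = \<bar>z\<bar> / ((real n + 1) * (a + real n)) * norm (c * z ^ n)"
    using a pochhammer_pos[OF a, of n]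
    by (simp add: c_def pochhammer_Suc abs_mult power_abs abs_of_pos divide_simps)
  also have "\<dots> \<le> 1 / 2 * norm (c * z ^ n)"
    by (intro mult_right_mono ratio) auto
  finally show "norm (1 / (fact (Suc n) * pochhammer a (Suc n)) * z ^ Suc n)
      \<le> 1 / 2 * norm (1 / (fact n * pochhammer a n) * z ^ n)"
    by (simp add: c_def)
qed simp

lemma hypergeom_0F1_pos:
  assumes "a > 0" "z \<ge> 0"
  shows "hypergeom_0F1 a z > 0"
proof -
  have "0 < (\<Sum>m. (1 / (fact m * pochhammer a m)) * z ^ m)"
    using assms by (intro suminf_pos2[of _ 0] summable_hypergeom_0F1) (auto simp: pochhammer_pos less_imp_le)
  then show ?thesis
    by (simp add: hypergeom_0F1_def)
qed

lemma hypergeom_0F1_zero [simp]: "hypergeom_0F1 a 0 = 1"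
  using powser_zero[of "\<lambda>m. 1 / (fact m * pochhammer a m)"] by (simp add: hypergeom_0F1_def)

text \<open>The remainder \<open>q\<close> is the power series with coefficients shifted by two; it
  is continuous at 0, where its value is the coefficient of \<open>z\<^sup>2\<close>.\<close>

lemma hypergeom_0F1_expansion:
  assumes a: "a > 0"
  obtains q where "(q \<longlongrightarrow> 1 / (2 * a * (a + 1))) (at 0)"
    and "\<And>z. hypergeom_0F1 a z = 1 + z / a + z\<^sup>2 * q z"
proof
  define c where "c m = 1 / (fact m * pochhammer a m)" for m
  let ?q = "\<lambda>z. \<Sum>m. c (Suc (Suc m)) * z ^ m"
  note s0 = summable_hypergeom_0F1[OF a, folded c_def]
  have s1: "summable (\<lambda>m. c (Suc m) * z ^ m)" for z
    using s0 by (rule powser_split_head(3))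
  have s2: "summable (\<lambda>m. c (Suc (Suc m)) * z ^ m)" for z
    using s1 by (rule powser_split_head(3))
  have c2: "c (Suc (Suc 0)) = 1 / (2 * a * (a + 1))"
    by (simp add: c_def pochhammer_Suc)
  have "isCont ?q 0"
    using s2 by (rule isCont_powser_converges_everywhere)
  moreover have "?q 0 = 1 / (2 * a * (a + 1))"
    using powser_zero[of "\<lambda>m. c (Suc (Suc m))"] c2 by simp
  ultimately show "(?q \<longlongrightarrow> 1 / (2 * a * (a + 1))) (at 0)"
    by (simp add: isCont_def)
  fix z
  have "hypergeom_0F1 a z = (\<Sum>m. c m * z ^ m)"
    by (simp add: hypergeom_0F1_def c_def)
  also have "\<dots> = c 0 + (c 1 + ?q z * z) * z"
    using powser_split_head(1)[OF s0[of z]] powser_split_head(1)[OF s1[of z]] by simp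
  finally show "hypergeom_0F1 a z = 1 + z / a + z\<^sup>2 * ?q z"
    by (simp add: c_def algebra_simps power2_eq_square)
qed

text \<open>Two expansions are multiplied. Since \<open>v * (1 / v) = 1\<close> and
  \<open>v\<^sup>2 + 1 / v\<^sup>2 = w\<^sup>2 - 2\<close>, the coefficients up to second order
  depend on \<open>v\<close> only through \<open>w\<close>.\<close>

lemma hypergeom_0F1_product_expansion:
  assumes a: "a > 0" and v: "v > 0" and w: "v + 1 / v = w"
  obtains R where "(R \<longlongrightarrow> (w\<^sup>2 - 2) / (2 * a * (a + 1)) + 1 / a\<^sup>2) (at_right 0)"
    and "\<And>s. hypergeom_0F1 a (s * v) * hypergeom_0F1 a (s / v) = 1 + w / a * s + s\<^sup>2 * R s"
proof -
  define k where "k = 1 / (2 * a * (a + 1))"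
  obtain q where q: "(q \<longlongrightarrow> k) (at 0)"
    and F: "\<And>z. hypergeom_0F1 a z = 1 + z / a + z\<^sup>2 * q z"
    using hypergeom_0F1_expansion[OF a] unfolding k_def by blast
  define v' where "v' = 1 / v"
  have v': "v' > 0" "v * v' = 1" "v + v' = w"
    using v w by (auto simp: v'_def)
  \<comment> \<open>The limit of \<open>q\<close> is a punctured one, so \<open>s * t\<close> has to
    avoid 0; this is where \<open>t > 0\<close> enters.\<close>
  have lim: "((\<lambda>s. q (s * t)) \<longlongrightarrow> k) (at_right 0)" if "t > 0" for t
  proof (rule filterlim_compose[OF q])
    have "((\<lambda>s. s * t) \<longlongrightarrow> 0 * t) (at_right 0)"
      by (intro tendsto_intros)
    then show "filterlim (\<lambda>s. s * t) (at 0) (at_right 0)"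
      using that by (auto simp: filterlim_at eventually_at_right_less intro: eventually_at_rightI[of 0 1])
  qed
  define R where "R s = v\<^sup>2 * q (s * v) + v'\<^sup>2 * q (s * v') + 1 / a\<^sup>2
      + s * (v * q (s * v) + v' * q (s * v')) / a + s\<^sup>2 * (q (s * v) * q (s * v'))" for s
  show thesis
  proof
    have "(R \<longlongrightarrow> v\<^sup>2 * k + v'\<^sup>2 * k + 1 / a\<^sup>2 + 0 * (v * k + v' * k) / a + 0\<^sup>2 * (k * k)) (at_right 0)"
      unfolding R_def using a v v' by (intro tendsto_intros lim) auto
    also have "v\<^sup>2 * k + v'\<^sup>2 * k + 1 / a\<^sup>2 + 0 * (v * k + v' * k) / a + 0\<^sup>2 * (k * k)
        = ((v + v')\<^sup>2 - 2 * (v * v')) * k + 1 / a\<^sup>2"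
      by (simp add: algebra_simps power2_eq_square)
    finally show "(R \<longlongrightarrow> (w\<^sup>2 - 2) / (2 * a * (a + 1)) + 1 / a\<^sup>2) (at_right 0)"
      by (simp add: v' k_def)
    fix s
    define \<alpha> where "\<alpha> = 1 / a"
    have "hypergeom_0F1 a (s * v) * hypergeom_0F1 a (s * v')
        = 1 + (v + v') * \<alpha> * s + s\<^sup>2 * (v\<^sup>2 * q (s * v) + v'\<^sup>2 * q (s * v') + (v * v') * \<alpha>\<^sup>2
          + s * (v * v') * (v * q (s * v) + v' * q (s * v')) * \<alpha>
          + s\<^sup>2 * (v * v')\<^sup>2 * (q (s * v) * q (s * v')))"
      unfolding F \<alpha>_def by (simp add: algebra_simps add_divide_distrib power2_eq_square)
    then show "hypergeom_0F1 a (s * v) * hypergeom_0F1 a (s / v) = 1 + w / a * s + s\<^sup>2 * R s"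
      by (simp add: v' R_def \<alpha>_def power_one_over) (simp add: v'_def)
  qed
qed

text \<open>The points 3, 4, 5 are equally spaced, so the first-order terms cancel, and the sign for
  small \<open>s\<close> is decided at second order.\<close>

lemma hypergeom_0F1_product_not_log_convex:
  fixes a v\<^sub>3 v\<^sub>4 v\<^sub>5 :: real
  defines "G \<equiv> \<lambda>v s. hypergeom_0F1 a (s * v) * hypergeom_0F1 a (s / v)"
  assumes a: "a > 0" and v: "v\<^sub>3 > 0" "v\<^sub>3 + 1 / v\<^sub>3 = 3" "v\<^sub>4 > 0" "v\<^sub>4 + 1 / v\<^sub>4 = 4"
    "v\<^sub>5 > 0" "v\<^sub>5 + 1 / v\<^sub>5 = 5"
  shows "\<exists>s>0. G v\<^sub>3 s * G v\<^sub>5 s < (G v\<^sub>4 s)\<^sup>2"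
proof (rule ccontr)
  assume contr: "\<not> ?thesis"
  define l where "l w = (w\<^sup>2 - 2) / (2 * a * (a + 1)) + 1 / a\<^sup>2" for w
  obtain R\<^sub>3 where R3: "(R\<^sub>3 \<longlongrightarrow> l 3) (at_right 0)" "\<And>s. G v\<^sub>3 s = 1 + 3 / a * s + s\<^sup>2 * R\<^sub>3 s"
    using hypergeom_0F1_product_expansion[OF a v(1,2)] unfolding l_def G_def by blast
  obtain R\<^sub>4 where R4: "(R\<^sub>4 \<longlongrightarrow> l 4) (at_right 0)" "\<And>s. G v\<^sub>4 s = 1 + 4 / a * s + s\<^sup>2 * R\<^sub>4 s"
    using hypergeom_0F1_product_expansion[OF a v(3,4)] unfolding l_def G_def by blast
  obtain R\<^sub>5 where R5: "(R\<^sub>5 \<longlongrightarrow> l 5) (at_right 0)" "\<And>s. G v\<^sub>5 s = 1 + 5 / a * s + s\<^sup>2 * R\<^sub>5 s"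
    using hypergeom_0F1_product_expansion[OF a v(5,6)] unfolding l_def G_def by blast
  define \<alpha> where "\<alpha> = 1 / a"
  \<comment> \<open>The difference divided by \<open>s\<^sup>2\<close>. The term
    \<open>- \<alpha>\<^sup>2\<close> is \<open>(3 * 5 - 4\<^sup>2) * \<alpha>\<^sup>2\<close>, from
    the products of linear terms.\<close>
  define E where "E s = R\<^sub>3 s + R\<^sub>5 s - 2 * R\<^sub>4 s - \<alpha>\<^sup>2
      + s * \<alpha> * (3 * R\<^sub>5 s + 5 * R\<^sub>3 s - 8 * R\<^sub>4 s) + s\<^sup>2 * (R\<^sub>3 s * R\<^sub>5 s - (R\<^sub>4 s)\<^sup>2)" for s
  have E: "G v\<^sub>3 s * G v\<^sub>5 s - (G v\<^sub>4 s)\<^sup>2 = s\<^sup>2 * E s" for s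
  proof -
    have "G v\<^sub>3 s = 1 + 3 * \<alpha> * s + s\<^sup>2 * R\<^sub>3 s" "G v\<^sub>4 s = 1 + 4 * \<alpha> * s + s\<^sup>2 * R\<^sub>4 s"
      "G v\<^sub>5 s = 1 + 5 * \<alpha> * s + s\<^sup>2 * R\<^sub>5 s"
      by (simp_all add: R3 R4 R5 \<alpha>_def)
    then show ?thesis
      unfolding E_def by (simp add: algebra_simps power2_eq_square)
  qed
  have nonneg: "E s \<ge> 0" if "s > 0" for s
  proof -
    have "0 \<le> s\<^sup>2 * E s"
      using contr that unfolding E[symmetric] by force
    then show ?thesis
      using that by (simp add: zero_le_mult_iff)
  qed
  have "(E \<longlongrightarrow> l 3 + l 5 - 2 * l 4 - \<alpha>\<^sup>2 + 0 * \<alpha> * (3 * l 5 + 5 * l 3 - 8 * l 4)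
      + 0\<^sup>2 * (l 3 * l 5 - (l 4)\<^sup>2)) (at_right 0)"
    unfolding E_def by (intro tendsto_intros R3 R4 R5)
  then have "0 \<le> l 3 + l 5 - 2 * l 4 - \<alpha>\<^sup>2 + 0 * \<alpha> * (3 * l 5 + 5 * l 3 - 8 * l 4)
      + 0\<^sup>2 * (l 3 * l 5 - (l 4)\<^sup>2)"
    by (rule tendsto_lowerbound)
       (auto intro!: eventually_at_rightI[of 0 1] nonneg)
  also have "\<dots> = 1 / (a * (a + 1)) - 1 / a\<^sup>2"
    by (simp add: l_def \<alpha>_def power_one_over add_divide_distrib[symmetric] diff_divide_distrib[symmetric])
  also have "\<dots> < 0"
    using a by (simp add: power2_eq_square divide_simps)
  finally show False by simp
qed

section \<open>The noncentral gamma density\<close>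

text \<open>The powers of \<open>v\<close> cancel, and the exponents add up to
  \<open>- b * u * (v + 1 / v)\<close>.\<close>

lemma noncentral_gamma_density_product:
  fixes a b \<theta> u v w :: real
  assumes u: "u > 0" and v: "v > 0" and w: "v + 1 / v = w"
  shows "noncentral_gamma_density a b \<theta> (u * v) * noncentral_gamma_density a b \<theta> (u / v)
    = (b powr a * exp (- \<theta>) / Gamma a * u powr (a - 1))\<^sup>2 * exp (- (b * u) * w)
      * (hypergeom_0F1 a (b * \<theta> * u * v) * hypergeom_0F1 a (b * \<theta> * u / v))"
proof -
  have "(u * v) powr (a - 1) * (u / v) powr (a - 1) = (u powr (a - 1))\<^sup>2"
    using u v by (simp add: powr_mult powr_divide power2_eq_square)
  moreover have "exp (- b * (u * v)) * exp (- b * (u / v)) = exp (- (b * u) * w)"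
    unfolding w[symmetric] exp_add[symmetric] by (simp add: algebra_simps)
  ultimately show ?thesis
    unfolding noncentral_gamma_density_def power_mult_distrib
    by (simp add: mult_ac power2_eq_square)
qed

lemma noncentral_gamma_density_pos:
  assumes "a > 0" "b > 0" "\<theta> \<ge> 0" "x > 0"
  shows "noncentral_gamma_density a b \<theta> x > 0"
  using assms by (simp add: noncentral_gamma_density_def Gamma_real_pos hypergeom_0F1_pos)

lemma not_hcm_noncentral_gamma_density:
  fixes a b \<theta> :: real
  assumes a: "a > 0" and b: "b > 0" and \<theta>: "\<theta> > 0"
  shows "\<not> hyperbolically_completely_monotone (noncentral_gamma_density a b \<theta>)"
proof
  let ?p = "noncentral_gamma_density a b \<theta>"
  define G where "G v s = hypergeom_0F1 a (s * v) * hypergeom_0F1 a (s / v)" for v s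
  assume hcm: "hyperbolically_completely_monotone ?p"
  have v: "hcm_v w > 0" "hcm_v w + 1 / hcm_v w = w" if "w > 2" for w
    using hcm_v_plus_inverse[OF that] by auto
  obtain s where s: "s > 0" "G (hcm_v 3) s * G (hcm_v 5) s < (G (hcm_v 4) s)\<^sup>2"
    using hypergeom_0F1_product_not_log_convex[OF a, of "hcm_v 3" "hcm_v 4" "hcm_v 5"] v
    unfolding G_def by auto
  \<comment> \<open>This \<open>u\<close> turns the arguments of the hypergeometric factors into
    \<open>s * v\<close> and \<open>s / v\<close>.\<close>
  define u where "u = s / (b * \<theta>)"
  have u: "u > 0" and s_eq: "b * \<theta> * u = s"
    using s b \<theta> by (auto simp: u_def)
  define K where "K = (b powr a * exp (- \<theta>) / Gamma a * u powr (a - 1))\<^sup>2"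
  define H where "H w = ?p (u * hcm_v w) * ?p (u / hcm_v w)" for w
  have H: "H w = K * exp (- (b * u) * w) * G (hcm_v w) s" if "w > 2" for w
    unfolding H_def K_def G_def noncentral_gamma_density_product[OF u v[OF that]] s_eq ..
  have "completely_monotone_on {2<..} H"
    using hcm u unfolding hyperbolically_completely_monotone_def H_def by blast
  moreover have "H 3 > 0"
    using a b \<theta> u v[of 3] by (simp add: H_def noncentral_gamma_density_pos)
  ultimately have "(H (3 + 1))\<^sup>2 \<le> H 3 * H (3 + 2 * 1)"
    by (intro completely_monotone_on_log_convex) auto
  then have "(K * exp (- (b * u) * 4))\<^sup>2 * (G (hcm_v 4) s)\<^sup>2
      \<le> K\<^sup>2 * (exp (- (b * u) * 3) * exp (- (b * u) * 5)) * (G (hcm_v 3) s * G (hcm_v 5) s)"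
    by (simp add: H power_mult_distrib power2_eq_square mult_ac)
  \<comment> \<open>As \<open>3 + 5 = 2 * 4\<close>, both sides carry the same positive exponential
    factor, which cancels.\<close>
  also have "K\<^sup>2 * (exp (- (b * u) * 3) * exp (- (b * u) * 5)) = (K * exp (- (b * u) * 4))\<^sup>2"
    by (simp add: power2_eq_square flip: exp_add)
  finally have "(G (hcm_v 4) s)\<^sup>2 \<le> G (hcm_v 3) s * G (hcm_v 5) s"
    using a b u Gamma_real_pos[OF a] by (simp add: K_def)
  with s show False by simp
qed

text \<open>At \<open>\<theta> = 0\<close> the hypergeometric factors are 1, which leaves a
  nonnegative constant times \<open>exp (- (b * u) * w)\<close>.\<close>

lemma hcm_gamma_density:
  fixes a b :: real
  assumes a: "a > 0" and b: "b > 0"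
  shows "hyperbolically_completely_monotone (noncentral_gamma_density a b 0)"
  unfolding hyperbolically_completely_monotone_def
proof (intro conjI allI impI)
  fix u :: real assume u: "u > 0"
  show "completely_monotone_on {2<..}
      (\<lambda>w. noncentral_gamma_density a b 0 (u * hcm_v w) * noncentral_gamma_density a b 0 (u / hcm_v w))"
  proof (rule completely_monotone_on_exp)
    fix w :: real assume "w \<in> {2<..}"
    then have "hcm_v w > 0" "hcm_v w + 1 / hcm_v w = w"
      using hcm_v_plus_inverse[of w] by auto
    from noncentral_gamma_density_product[OF u this]
    show "noncentral_gamma_density a b 0 (u * hcm_v w) * noncentral_gamma_density a b 0 (u / hcm_v w)
        = (b powr a * exp (- 0) / Gamma a * u powr (a - 1))\<^sup>2 * exp (- (b * u) * w)"
      by simp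
  qed (use b u in auto)
qed (use a b noncentral_gamma_density_pos in auto)

theorem theorem1:
  fixes a b \<theta> :: real
  assumes "a > 0" and "b > 0" and "\<theta> \<ge> 0"
  shows "hyperbolically_completely_monotone (noncentral_gamma_density a b \<theta>) \<longleftrightarrow> \<theta> = 0"
proof (cases "\<theta> = 0")
  case True
  with assms show ?thesis
    by (simp add: hcm_gamma_density)
next
  case False
  with assms show ?thesis
    using not_hcm_noncentral_gamma_density[of a b \<theta>] by simp
qed

end
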